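(* Let $n\ge1$ and let $(X_0,X_1,\dotsc,X_n)$ be a discrete-time martingale with respect to $(E_1,\dots,E_n)$ such that $X_n\in\{0,1\}$. Then $$\sup_{\tau}\ \mathbb{E}\big[(X_\tau-X_{\tau-1})^2\big]\ \geq\ \frac1n X_0(1-X_0),$$ the supremum being over stopping times $\tau$ with values in $\{1,\dots,n\}$. Furthermore, for all $n\geq1$ and $X_0\in[0,1]$, there exists a martingale $(X_0,\dotsc,X_n)$ with $X_n\in\{0,1\}$ such that every stopping time $\tau$ satisfies $\mathbb{E}[(X_\tau-X_{\tau-1})^2]=\frac1n X_0(1-X_0)$.
   Context: A stopping time is a random variable $\tau$ such that for each $k$ the event $\{\tau\le k\}$ is determined by $E_1,\dots,E_k$. *)

theory Defs
  imports "HOL-Probability.Probability"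
begin

text \<open>
  The \<open>k\<close>-th member is the \<open>\<sigma>\<close>-algebra on \<open>space M\<close> generated by the random vector
  \<open>(E 1, \<dots>, E k)\<close>, where \<open>E i\<close> takes values in the measurable space \<open>S i\<close>. For \<open>k = 0\<close> the
  product is a one-point space, so the \<open>\<sigma>\<close>-algebra is trivial and a function measurable with
  respect to it is constant on \<open>space M\<close>.
\<close>

definition generated_filtration ::
  "'a measure \<Rightarrow> (nat \<Rightarrow> 'e measure) \<Rightarrow> (nat \<Rightarrow> 'a \<Rightarrow> 'e) \<Rightarrow> nat \<Rightarrow> 'a measure" where
  "generated_filtration M S E k =
     vimage_algebra (space M) (\<lambda>\<omega>. \<lambda>i\<in>{1..k}. E i \<omega>) (Pi\<^sub>M {1..k} S)"

definition martingale_wrt ::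
  "'a measure \<Rightarrow> (nat \<Rightarrow> 'e measure) \<Rightarrow> (nat \<Rightarrow> 'a \<Rightarrow> 'e) \<Rightarrow> nat \<Rightarrow> (nat \<Rightarrow> 'a \<Rightarrow> real) \<Rightarrow> bool" where
  "martingale_wrt M S E n X \<longleftrightarrow>
     (\<forall>k\<in>{1..n}. E k \<in> M \<rightarrow>\<^sub>M S k) \<and>
     (\<forall>k\<le>n. X k \<in> borel_measurable (generated_filtration M S E k)) \<and>
     (\<forall>k\<le>n. integrable M (X k)) \<and>
     (\<forall>k<n. AE \<omega> in M. real_cond_exp M (generated_filtration M S E k) (X (Suc k)) \<omega> = X k \<omega>)"

text \<open>
  The library's \<open>stopping_time\<close> asks for measurability of \<open>{\<tau> \<le> t}\<close> at all times \<open>t\<close>. As \<open>\<tau> \<le> n\<close>,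
  this event is the whole space once \<open>t \<ge> n\<close>, so the variables \<open>E i\<close> with \<open>i > n\<close> play no role.
\<close>

definition stopping_times_upto ::
  "'a measure \<Rightarrow> (nat \<Rightarrow> 'e measure) \<Rightarrow> (nat \<Rightarrow> 'a \<Rightarrow> 'e) \<Rightarrow> nat \<Rightarrow> ('a \<Rightarrow> nat) set" where
  "stopping_times_upto M S E n =
     {\<tau>. stopping_time (generated_filtration M S E) \<tau> \<and> (\<forall>\<omega>\<in>space M. \<tau> \<omega> \<in> {1..n})}"

text \<open>
  If \<open>X n \<in> {0, 1}\<close> almost surely, every \<open>X k\<close> lies in \<open>[0, 1]\<close> almost surely, so the integrand
  below is integrable with integral in \<open>[0, 1]\<close> for every such \<open>\<tau>\<close>. For \<open>n \<ge> 1\<close> there is at least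
  one such \<open>\<tau>\<close>, hence the real-valued supremum over them is of a nonempty bounded set.
\<close>

definition stopped_gap :: "'a measure \<Rightarrow> (nat \<Rightarrow> 'a \<Rightarrow> real) \<Rightarrow> ('a \<Rightarrow> nat) \<Rightarrow> real" where
  "stopped_gap M X \<tau> = (\<integral>\<omega>. (X (\<tau> \<omega>) \<omega> - X (\<tau> \<omega> - 1) \<omega>)\<^sup>2 \<partial>M)"

end

theory Submission imports Defs begin

text \<open>
  Lower bound: martingale increments are orthogonal, so the deterministic times \<open>\<tau> = 1, \<dots>, n\<close> have
  expected squared increments adding up to \<open>E[X\<^sub>n\<^sup>2] - X\<^sub>0\<^sup>2 = X\<^sub>0 (1 - X\<^sub>0)\<close>, and the best of them is at
  least the average.

  Extremal martingale: the process moves so that stopping now and going on for the remaining \<open>m\<close>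
  steps are worth the same. Going on from \<open>y\<close> is worth \<open>y (1 - y) / m\<close>, so from \<open>x\<close> the process must
  jump to a root of \<open>m (y - x)\<^sup>2 = y (1 - y)\<close>. The two roots enclose \<open>x\<close>, and choosing between them
  with mean \<open>x\<close> gives conditional variance \<open>x (1 - x) / (m + 1)\<close>. Hence the squared increments form a
  martingale themselves, and optional stopping shows that every \<open>\<tau>\<close> yields \<open>X\<^sub>0 (1 - X\<^sub>0) / n\<close>.
\<close>

section \<open>The lower bound\<close>

text \<open>Sets that never separate outcomes with equal first \<open>k\<close> observations form a
  sigma-algebra containing the generating preimages.\<close>

lemma generated_filtration_determined:
  assumes "A \<in> sets (generated_filtration M S E k)" "\<omega> \<in> space M" "\<omega>' \<in> space M"
    and "\<And>i. i \<in> {1..k} \<Longrightarrow> E i \<omega> = E i \<omega>'"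
  shows "\<omega> \<in> A \<longleftrightarrow> \<omega>' \<in> A"
proof -
  define f where "f = (\<lambda>\<omega>. \<lambda>i\<in>{1..k}. E i \<omega>)"
  have eq: "f \<omega> = f \<omega>'"
    unfolding f_def by (rule restrict_cong) (simp_all add: assms(4) simp_implies_def)
  have "A \<in> sigma_sets (space M) {f -` B \<inter> space M |B. B \<in> sets (Pi\<^sub>M {1..k} S)}"
    using assms(1) unfolding generated_filtration_def sets_vimage_algebra f_def .
  then show ?thesis
    using eq assms(2,3)
  proof (induction rule: sigma_sets.induct[consumes 1, case_names Basic Empty Compl Union])
    case (Basic a)
    then show ?case by auto
  qed auto
qed

lemma space_generated_filtration [simp]: "space (generated_filtration M S E k) = space M"
  by (simp add: generated_filtration_def)

lemma subalgebra_generated_filtration: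
  assumes "\<And>i. i \<in> {1..k} \<Longrightarrow> E i \<in> M \<rightarrow>\<^sub>M S i"
  shows "subalgebra M (generated_filtration M S E k)"
proof -
  have "(\<lambda>\<omega>. \<lambda>i\<in>{1..k}. E i \<omega>) \<in> M \<rightarrow>\<^sub>M Pi\<^sub>M {1..k} S"
    using assms by (intro measurable_restrict)
  then show ?thesis
    unfolding subalgebra_def generated_filtration_def
    by (auto simp: sets_vimage_algebra intro!: sets.sigma_sets_subset measurable_sets)
qed

lemma martingale_wrtD:
  assumes "martingale_wrt M S E n X"
  shows "k \<in> {1..n} \<Longrightarrow> E k \<in> M \<rightarrow>\<^sub>M S k"
    and "k \<le> n \<Longrightarrow> X k \<in> borel_measurable (generated_filtration M S E k)"
    and "k \<le> n \<Longrightarrow> integrable M (X k)"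
    and "k \<le> n \<Longrightarrow> X k \<in> borel_measurable M"
    and "k < n \<Longrightarrow> AE \<omega> in M. real_cond_exp M (generated_filtration M S E k) (X (Suc k)) \<omega> = X k \<omega>"
  using assms unfolding martingale_wrt_def by (blast intro: borel_measurable_integrable)+

lemma const_stopping_time:
  assumes "k \<in> {1..n}"
  shows "(\<lambda>_. k) \<in> stopping_times_upto M S E n"
  using assms by (auto simp: stopping_times_upto_def stopping_time_const)

lemma (in prob_space) martingale_wrt_imp_sigma_finite_subalgebra:
  assumes "martingale_wrt M S E n X" "k \<le> n"
  shows "sigma_finite_subalgebra M (generated_filtration M S E k)"
proof (rule finite_measure_subalgebra_is_sigma_finite)
  show "finite_measure_subalgebra M (generated_filtration M S E k)"
    unfolding finite_measure_subalgebra_def finite_measure_subalgebra_axioms_def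
    using assms(2) by (intro conjI finite_measure_axioms subalgebra_generated_filtration
        martingale_wrtD(1)[OF assms(1)]) simp
qed

text \<open>Conditional expectation preserves almost sure bounds and the mean, so both claims
  descend from time \<open>n\<close>, where the values are known.\<close>

lemma (in prob_space)
  assumes X: "martingale_wrt M S E n X" and bin: "AE \<omega> in M. X n \<omega> \<in> {0, 1}"
  shows martingale_bounds: "AE \<omega> in M. \<forall>k\<le>n. X k \<omega> \<in> {0..1}"
    and martingale_expectation: "k \<le> n \<Longrightarrow> expectation (X k) = expectation (X n)"
proof -
  have "(AE \<omega> in M. X k \<omega> \<in> {0..1}) \<and> expectation (X k) = expectation (X n)" if "k \<le> n" for k
    using that
  proof (induction rule: inc_induct)
    case base
    have "AE \<omega> in M. X n \<omega> \<in> {0..1}"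
      using bin by eventually_elim auto
    then show ?case by simp
  next
    case (step k)
    interpret sigma_finite_subalgebra M "generated_filtration M S E k"
      using martingale_wrt_imp_sigma_finite_subalgebra[OF X] step.hyps by simp
    let ?C = "real_cond_exp M (generated_filtration M S E k) (X (Suc k))"
    have int: "integrable M (X (Suc k))" and eq: "AE \<omega> in M. ?C \<omega> = X k \<omega>"
      and [measurable]: "X k \<in> borel_measurable M"
      using martingale_wrtD[OF X] step.hyps by simp_all
    from step.IH have "AE \<omega> in M. X (Suc k) \<omega> \<ge> 0" "AE \<omega> in M. X (Suc k) \<omega> \<le> 1"
      by auto
    from real_cond_exp_ge_c[OF int this(1)] real_cond_exp_le_c[OF int this(2)] eq
    have bounds: "AE \<omega> in M. X k \<omega> \<in> {0..1}"
      by eventually_elim auto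
    have "expectation (X k) = expectation ?C"
    proof (rule integral_cong_AE)
      show "AE \<omega> in M. X k \<omega> = ?C \<omega>"
        using eq by eventually_elim simp
    qed simp_all
    also have "\<dots> = expectation (X (Suc k))"
      by (rule real_cond_exp_int(2)[OF int])
    also have "\<dots> = expectation (X n)"
      using step.IH by (rule conjunct2)
    finally show ?case
      using bounds by (intro conjI)
  qed
  note * = this
  show "AE \<omega> in M. \<forall>k\<le>n. X k \<omega> \<in> {0..1}"
    unfolding AE_all_countable by (intro allI AE_impI conjunct1[OF *])
  show "expectation (X k) = expectation (X n)" if "k \<le> n"
    using *[OF that] by (rule conjunct2)
qed

lemma (in prob_space) martingale_integrable_mult:
  assumes X: "martingale_wrt M S E n X" and bin: "AE \<omega> in M. X n \<omega> \<in> {0, 1}"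
    and "j \<le> n" "k \<le> n"
  shows "integrable M (\<lambda>\<omega>. X j \<omega> * X k \<omega>)"
proof (rule integrable_const_bound[of _ 1])
  show "AE \<omega> in M. norm (X j \<omega> * X k \<omega>) \<le> 1"
    using martingale_bounds[OF X bin]
    by eventually_elim (use assms(3,4) in \<open>auto simp: abs_mult intro!: mult_le_one\<close>)
  show "(\<lambda>\<omega>. X j \<omega> * X k \<omega>) \<in> borel_measurable M"
    using martingale_wrtD(4)[OF X] assms(3,4) by simp
qed

text \<open>Orthogonality of increments: \<open>X k\<close>, being known at time \<open>k\<close>,
  moves inside the conditional expectation of \<open>X (Suc k)\<close>, so the cross moment equals
  the second moment of \<open>X k\<close>.\<close>

lemma (in prob_space) martingale_increment_square:
  assumes X: "martingale_wrt M S E n X" and bin: "AE \<omega> in M. X n \<omega> \<in> {0, 1}" and k: "k < n"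
  shows "expectation (\<lambda>\<omega>. (X (Suc k) \<omega> - X k \<omega>)\<^sup>2)
    = expectation (\<lambda>\<omega>. (X (Suc k) \<omega>)\<^sup>2) - expectation (\<lambda>\<omega>. (X k \<omega>)\<^sup>2)"
proof -
  interpret sigma_finite_subalgebra M "generated_filtration M S E k"
    using martingale_wrt_imp_sigma_finite_subalgebra[OF X] k by simp
  let ?C = "real_cond_exp M (generated_filtration M S E k) (X (Suc k))"
  note int = martingale_integrable_mult[OF X bin]
  have [measurable]: "X k \<in> borel_measurable M" "X (Suc k) \<in> borel_measurable M"
    and eq: "AE \<omega> in M. ?C \<omega> = X k \<omega>"
    and meas: "X k \<in> borel_measurable (generated_filtration M S E k)"
    using martingale_wrtD[OF X] k by simp_all
  have "expectation (\<lambda>\<omega>. X k \<omega> * X (Suc k) \<omega>) = expectation (\<lambda>\<omega>. X k \<omega> * ?C \<omega>)"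
    using k by (intro real_cond_exp_intg(2)[symmetric] int meas) auto
  also have "\<dots> = expectation (\<lambda>\<omega>. X k \<omega> * X k \<omega>)"
  proof (rule integral_cong_AE)
    show "AE \<omega> in M. X k \<omega> * ?C \<omega> = X k \<omega> * X k \<omega>"
      using eq by eventually_elim simp
  qed simp_all
  finally have cross: "expectation (\<lambda>\<omega>. X k \<omega> * X (Suc k) \<omega>) = expectation (\<lambda>\<omega>. X k \<omega> * X k \<omega>)" .
  have "expectation (\<lambda>\<omega>. (X (Suc k) \<omega> - X k \<omega>)\<^sup>2)
      = expectation (\<lambda>\<omega>. X (Suc k) \<omega> * X (Suc k) \<omega> + X k \<omega> * X k \<omega> - 2 * (X k \<omega> * X (Suc k) \<omega>))"
    by (intro Bochner_Integration.integral_cong refl) (simp add: power2_eq_square algebra_simps)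
  also have "\<dots> = expectation (\<lambda>\<omega>. X (Suc k) \<omega> * X (Suc k) \<omega>) + expectation (\<lambda>\<omega>. X k \<omega> * X k \<omega>)
      - 2 * expectation (\<lambda>\<omega>. X k \<omega> * X (Suc k) \<omega>)"
    using k by (simp add: int)
  finally show ?thesis
    by (simp add: cross power2_eq_square)
qed

lemma (in prob_space) stopped_gap_le_1:
  assumes X: "martingale_wrt M S E n X" and bin: "AE \<omega> in M. X n \<omega> \<in> {0, 1}"
    and \<tau>: "\<tau> \<in> stopping_times_upto M S E n"
  shows "stopped_gap M X \<tau> \<le> 1"
proof -
  have "AE \<omega> in M. (X (\<tau> \<omega>) \<omega> - X (\<tau> \<omega> - 1) \<omega>)\<^sup>2 \<le> 1"
    using martingale_bounds[OF X bin] AE_space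
  proof eventually_elim
    case (elim \<omega>)
    have "\<tau> \<omega> \<in> {1..n}"
      using \<tau> elim(2) by (auto simp: stopping_times_upto_def)
    then have "X (\<tau> \<omega>) \<omega> \<in> {0..1}" "X (\<tau> \<omega> - 1) \<omega> \<in> {0..1}"
      using elim(1) by auto
    then show ?case
      by (auto simp: abs_square_le_1)
  qed
  then have "expectation (\<lambda>\<omega>. (X (\<tau> \<omega>) \<omega> - X (\<tau> \<omega> - 1) \<omega>)\<^sup>2) \<le> 1"
    \<comment> \<open>The case split spares a measurability proof: a non-integrable function has
      integral 0 by convention.\<close>
    by (cases "integrable M (\<lambda>\<omega>. (X (\<tau> \<omega>) \<omega> - X (\<tau> \<omega> - 1) \<omega>)\<^sup>2)")
       (auto intro!: integral_le_const simp: not_integrable_integral_eq)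
  then show ?thesis
    by (simp add: stopped_gap_def)
qed

lemma (in prob_space) sup_stopped_gap_ge:
  assumes n: "n \<ge> 1" and X: "martingale_wrt M S E n X" and bin: "AE \<omega> in M. X n \<omega> \<in> {0, 1}"
    and \<omega>\<^sub>0: "\<omega>\<^sub>0 \<in> space M"
  shows "1 / real n * (X 0 \<omega>\<^sub>0 * (1 - X 0 \<omega>\<^sub>0)) \<le> (SUP \<tau>\<in>stopping_times_upto M S E n. stopped_gap M X \<tau>)"
    (is "_ \<le> ?sup")
proof -
  \<comment> \<open>The sigma-algebra at time 0 separates no points, so a level set of
    \<open>X 0\<close> is empty or everything; \<open>X 0\<close> is constant everywhere, not just
    almost everywhere.\<close>
  have X0: "X 0 \<omega> = X 0 \<omega>\<^sub>0" if "\<omega> \<in> space M" for \<omega>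
  proof -
    have "X 0 \<in> borel_measurable (generated_filtration M S E 0)"
      using martingale_wrtD(2)[OF X] by simp
    then have "X 0 -` {X 0 \<omega>\<^sub>0} \<inter> space M \<in> sets (generated_filtration M S E 0)"
      using measurable_sets[of "X 0" "generated_filtration M S E 0" borel "{X 0 \<omega>\<^sub>0}"] by simp
    from generated_filtration_determined[OF this \<omega>\<^sub>0 that] show ?thesis
      using \<omega>\<^sub>0 that by simp
  qed
  have le: "expectation (\<lambda>\<omega>. (X (Suc k) \<omega> - X k \<omega>)\<^sup>2) \<le> ?sup" if "k < n" for k
  proof -
    have "stopped_gap M X (\<lambda>_. Suc k) \<le> ?sup"
      using that by (intro cSUP_upper const_stopping_time bdd_aboveI2[of _ _ 1] stopped_gap_le_1[OF X bin]) auto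
    then show ?thesis
      by (simp add: stopped_gap_def)
  qed
  \<comment> \<open>Squaring fixes 0 and 1, so the second moment at time \<open>n\<close> is the
    mean, which the martingale property carries back to time 0.\<close>
  have "expectation (\<lambda>\<omega>. (X n \<omega>)\<^sup>2) = expectation (X n)"
  proof (rule integral_cong_AE)
    show "AE \<omega> in M. (X n \<omega>)\<^sup>2 = X n \<omega>"
      using bin by eventually_elim auto
  qed (use martingale_wrtD(4)[OF X, of n] in simp_all)
  also have "\<dots> = expectation (X 0)"
    using martingale_expectation[OF X bin, of 0] by simp
  also have "\<dots> = expectation (\<lambda>_. X 0 \<omega>\<^sub>0)"
    using X0 by (intro Bochner_Integration.integral_cong) auto
  finally have "expectation (\<lambda>\<omega>. (X n \<omega>)\<^sup>2) = X 0 \<omega>\<^sub>0"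
    by (simp add: prob_space)
  moreover have "expectation (\<lambda>\<omega>. (X 0 \<omega>)\<^sup>2) = expectation (\<lambda>_. (X 0 \<omega>\<^sub>0)\<^sup>2)"
    using X0 by (intro Bochner_Integration.integral_cong) auto
  ultimately have "X 0 \<omega>\<^sub>0 * (1 - X 0 \<omega>\<^sub>0) = expectation (\<lambda>\<omega>. (X n \<omega>)\<^sup>2) - expectation (\<lambda>\<omega>. (X 0 \<omega>)\<^sup>2)"
    by (simp add: prob_space power2_eq_square algebra_simps)
  also have "\<dots> = (\<Sum>k<n. expectation (\<lambda>\<omega>. (X (Suc k) \<omega>)\<^sup>2) - expectation (\<lambda>\<omega>. (X k \<omega>)\<^sup>2))"
    by (rule sum_lessThan_telescope[symmetric])
  also have "\<dots> = (\<Sum>k<n. expectation (\<lambda>\<omega>. (X (Suc k) \<omega> - X k \<omega>)\<^sup>2))"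
    by (simp add: martingale_increment_square[OF X bin])
  also have "\<dots> \<le> real n * ?sup"
    using sum_bounded_above[of "{..<n}" _ ?sup] le by simp
  finally show ?thesis
    using n by (simp add: field_simps)
qed

section \<open>The extremal martingale\<close>

text \<open>\<open>up\<close> and \<open>down\<close> are the roots in \<open>y\<close> of
  \<open>(m + 1) * y^2 - (2 * m * x + 1) * y + m * x^2 = 0\<close>, the indifference equation
  rearranged; \<open>m\<close> counts the steps left after the jump.\<close>

definition up :: "real \<Rightarrow> real \<Rightarrow> real" where
  "up m x = (2 * m * x + 1 + sqrt (1 + 4 * m * x * (1 - x))) / (2 * (m + 1))"

definition down :: "real \<Rightarrow> real \<Rightarrow> real" where
  "down m x = (2 * m * x + 1 - sqrt (1 + 4 * m * x * (1 - x))) / (2 * (m + 1))"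

definition up_prob :: "real \<Rightarrow> real \<Rightarrow> real" where
  "up_prob m x = (x - down m x) / (up m x - down m x)"

context
  fixes m x :: real
  assumes m: "m \<ge> 0" and x: "x \<in> {0..1}"
begin

text \<open>Completing the square: up to the factor \<open>4 * (m + 1)\<close>, the difference of
  the two sides is a square minus the discriminant.\<close>

lemma root_indifferent:
  assumes "y \<in> {up m x, down m x}"
  shows "m * (y - x)\<^sup>2 = y * (1 - y)"
proof -
  define s where "s = sqrt (1 + 4 * m * x * (1 - x))"
  have s: "s\<^sup>2 = 1 + 4 * m * x * (1 - x)"
    using m x by (simp add: s_def)
  \<comment> \<open>\<open>e\<close> is the sign of the square root, so that both roots are treated
    at once.\<close>
  obtain e :: real where e: "e * e = 1" "y * (2 * (m + 1)) = 2 * m * x + 1 + e * s"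
  proof (cases "y = up m x")
    case True
    then show ?thesis using m by (intro that[of 1]) (auto simp: up_def s_def field_simps)
  next
    case False
    then show ?thesis using m assms by (intro that[of "-1"]) (auto simp: down_def s_def field_simps)
  qed
  have "4 * (m + 1) * (m * (y - x)\<^sup>2 - y * (1 - y)) =
      (y * (2 * (m + 1)) - (2 * m * x + 1))\<^sup>2 - (1 + 4 * m * x * (1 - x))"
    by (simp add: power2_eq_square algebra_simps)
  also have "\<dots> = (e * e) * s\<^sup>2 - s\<^sup>2"
    unfolding e(2) s[symmetric] by (simp add: power2_eq_square)
  finally show ?thesis
    using m e(1) by simp
qed

text \<open>By indifference \<open>y * (1 - y)\<close> is a nonnegative multiple of a square, which
  forces \<open>y\<close> into the unit interval.\<close>

lemma root_bounds:
  assumes "y \<in> {up m x, down m x}"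
  shows "y \<in> {0..1}"
proof -
  have "0 \<le> y * (1 - y)"
    using root_indifferent[OF assms, symmetric] m by simp
  then show ?thesis
    by (auto simp: zero_le_mult_iff)
qed

text \<open>The square root \<open>s\<close> is at least 1, hence at least the absolute value of
  \<open>1 - 2 * x\<close>. This makes \<open>up_prob\<close> a well-defined probability.\<close>

lemma roots_enclose: "down m x \<le> x" "x \<le> up m x" "down m x < up m x"
proof -
  define s where "s = sqrt (1 + 4 * m * x * (1 - x))"
  have s: "1 \<le> s"
    using m x by (simp add: s_def)
  show "down m x \<le> x" "x \<le> up m x"
    unfolding up_def down_def s_def[symmetric] using m s x by (simp_all add: field_simps)
  show "down m x < up m x"
    unfolding up_def down_def s_def[symmetric] using m s by (intro divide_strict_right_mono) auto
qed

lemma up_prob_bounds: "0 \<le> up_prob m x" "up_prob m x \<le> 1"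
  using roots_enclose by (auto simp: up_prob_def)

lemma up_prob_mean: "up_prob m x * up m x + (1 - up_prob m x) * down m x = x"
proof -
  have "up_prob m x * (up m x - down m x) = x - down m x"
    using roots_enclose(3) by (simp add: up_prob_def)
  then show ?thesis
    by (simp add: algebra_simps)
qed

text \<open>A two-point law with mean \<open>x\<close> has variance
  \<open>(x - down m x) * (up m x - x)\<close>, here a difference of squares. The result is the
  value with \<open>m + 1\<close> steps left, which closes the recursion.\<close>

lemma up_prob_variance:
  "up_prob m x * (up m x - x)\<^sup>2 + (1 - up_prob m x) * (down m x - x)\<^sup>2 = x * (1 - x) / (m + 1)"
proof -
  define s where "s = sqrt (1 + 4 * m * x * (1 - x))"
  have s: "s\<^sup>2 = 1 + 4 * m * x * (1 - x)"
    using m x by (simp add: s_def)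
  have "up_prob m x * (up m x - x)\<^sup>2 + (1 - up_prob m x) * (down m x - x)\<^sup>2
      = (up_prob m x * up m x + (1 - up_prob m x) * down m x - x) * (up m x + down m x - 2 * x)
        + (x - down m x) * (up m x - x)"
    by (simp add: power2_eq_square algebra_simps)
  also have "\<dots> = (x - down m x) * (up m x - x)"
    by (simp add: up_prob_mean)
  also have "\<dots> = (s\<^sup>2 - (1 - 2 * x)\<^sup>2) / (4 * (m + 1)\<^sup>2)"
  proof -
    have *: "x - down m x = (s - (1 - 2 * x)) / (2 * (m + 1))"
         "up m x - x = (s + (1 - 2 * x)) / (2 * (m + 1))"
      unfolding up_def down_def s_def[symmetric] using m by (simp_all add: field_simps)
    show ?thesis
      unfolding * by (simp add: power2_eq_square algebra_simps)
  qed
  also have "s\<^sup>2 - (1 - 2 * x)\<^sup>2 = 4 * (m + 1) * (x * (1 - x))"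
    unfolding s by (simp add: power2_eq_square algebra_simps)
  also have "4 * (m + 1) * (x * (1 - x)) / (4 * (m + 1)\<^sup>2) = x * (1 - x) / (m + 1)"
    using m by (simp add: power2_eq_square divide_simps)
  finally show ?thesis .
qed

end

text \<open>The last jump has \<open>m = 0\<close>; this is what lands the walk in 0 or 1.\<close>

lemma up_0 [simp]: "up 0 x = 1" and down_0 [simp]: "down 0 x = 0"
  by (simp_all add: up_def down_def)

lemma up_measurable [measurable]: "up m \<in> borel_measurable borel"
  and down_measurable [measurable]: "down m \<in> borel_measurable borel"
  unfolding up_def[abs_def] down_def[abs_def] by measurable

section \<open>The walk driven by coins\<close>

text \<open>A deterministic function of the coin record, with every coordinate other than 1 read as
  down, so its bounds hold for all records and not only on the support. After the move,
  \<open>n - Suc k\<close> steps are left.\<close>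

primrec walk :: "nat \<Rightarrow> real \<Rightarrow> nat \<Rightarrow> (nat \<Rightarrow> real) \<Rightarrow> real" where
  "walk n x 0 \<omega> = x"
| "walk n x (Suc k) \<omega> =
     (if \<omega> (Suc k) = 1 then up (real (n - Suc k)) (walk n x k \<omega>)
      else down (real (n - Suc k)) (walk n x k \<omega>))"

text \<open>
  The law of the first \<open>k\<close> coordinates, \<open>1\<close> encoding an up move; all later coordinates are \<open>0\<close>. It has
  finite support, so no integrability or joint measurability needs to be checked below.
\<close>
primrec coins :: "nat \<Rightarrow> real \<Rightarrow> nat \<Rightarrow> (nat \<Rightarrow> real) pmf" where
  "coins n x 0 = return_pmf (\<lambda>_. 0)"
| "coins n x (Suc k) = coins n x k \<bind>
     (\<lambda>\<omega>. map_pmf (\<lambda>b. fun_upd \<omega> (Suc k) (of_bool b))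
        (bernoulli_pmf (up_prob (real (n - Suc k)) (walk n x k \<omega>))))"

text \<open>Pointwise stand-in for measurability at time \<open>k\<close>: later coins can be
  overwritten freely.\<close>

definition determined_upto :: "nat \<Rightarrow> ((nat \<Rightarrow> real) \<Rightarrow> 'b) \<Rightarrow> bool" where
  "determined_upto k f \<longleftrightarrow> (\<forall>\<omega> \<omega>'. (\<forall>i\<in>{1..k}. \<omega> i = \<omega>' i) \<longrightarrow> f \<omega> = f \<omega>')"

abbreviation coordinate_filtration :: "(nat \<Rightarrow> real) measure \<Rightarrow> nat \<Rightarrow> (nat \<Rightarrow> real) measure" where
  "coordinate_filtration M \<equiv> generated_filtration M (\<lambda>_. borel) (\<lambda>i \<omega>. \<omega> i)"

lemma determined_upto_fun_upd:
  "determined_upto k f \<Longrightarrow> k < i \<Longrightarrow> f (fun_upd \<omega> i y) = f \<omega>"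
  unfolding determined_upto_def by (metis atLeastAtMost_iff fun_upd_other leD)

lemma determined_upto_mono: "determined_upto j f \<Longrightarrow> j \<le> k \<Longrightarrow> determined_upto k f"
  by (auto simp: determined_upto_def)

lemma determined_upto_comp2:
  "determined_upto k f \<Longrightarrow> determined_upto k g \<Longrightarrow> determined_upto k (\<lambda>\<omega>. h (f \<omega>) (g \<omega>))"
  unfolding determined_upto_def by metis

lemma determined_upto_walk: "determined_upto k (walk n x k)"
proof (induction k)
  case 0
  show ?case by (simp add: determined_upto_def)
next
  case (Suc k)
  show ?case
    unfolding determined_upto_def
  proof (intro allI impI)
    fix \<omega> \<omega>' :: "nat \<Rightarrow> real"
    assume *: "\<forall>i\<in>{1..Suc k}. \<omega> i = \<omega>' i"
    then have "\<forall>i\<in>{1..k}. \<omega> i = \<omega>' i"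
      by simp
    with Suc have "walk n x k \<omega> = walk n x k \<omega>'"
      unfolding determined_upto_def by blast
    moreover have "\<omega> (Suc k) = \<omega>' (Suc k)"
      using * by simp
    ultimately show "walk n x (Suc k) \<omega> = walk n x (Suc k) \<omega>'"
      by simp
  qed
qed

text \<open>Serves both the test sets of conditional expectations and the events of a stopping
  time.\<close>

lemma determined_upto_indicator:
  assumes "A \<in> sets (coordinate_filtration (measure_pmf P) k)"
  shows "determined_upto k (indicator A :: _ \<Rightarrow> real)"
  unfolding determined_upto_def
proof (intro allI impI)
  fix \<omega> \<omega>' :: "nat \<Rightarrow> real"
  assume "\<forall>i\<in>{1..k}. \<omega> i = \<omega>' i"
  then have "\<omega> \<in> A \<longleftrightarrow> \<omega>' \<in> A"
    by (intro generated_filtration_determined[OF assms]) auto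
  then show "indicator A \<omega> = (indicator A \<omega>' :: real)"
    by (simp add: indicator_def)
qed

section \<open>Expectations under the coin law\<close>

context
  fixes n :: nat and x :: real
  assumes x: "x \<in> {0..1}"
begin

lemma walk_bounds: "walk n x k \<omega> \<in> {0..1}"
proof (induction k)
  case (Suc k)
  then show ?case
    using root_bounds[of "real (n - Suc k)" "walk n x k \<omega>" "walk n x (Suc k) \<omega>"] by simp
qed (use x in simp)

lemma finite_set_pmf_coins: "finite (set_pmf (coins n x k))"
  by (induction k) auto

lemma integrable_coins [simp]:
  fixes f :: "(nat \<Rightarrow> real) \<Rightarrow> real"
  shows "integrable (measure_pmf (coins n x k)) f"
  by (intro integrable_measure_pmf_finite finite_set_pmf_coins)

lemma expectation_coins_Suc:
  fixes f :: "(nat \<Rightarrow> real) \<Rightarrow> real"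
  shows "measure_pmf.expectation (coins n x (Suc k)) f =
    measure_pmf.expectation (coins n x k) (\<lambda>\<omega>.
      up_prob (real (n - Suc k)) (walk n x k \<omega>) * f (fun_upd \<omega> (Suc k) 1) +
      (1 - up_prob (real (n - Suc k)) (walk n x k \<omega>)) * f (fun_upd \<omega> (Suc k) 0))"
proof -
  let ?p = "\<lambda>\<omega>. up_prob (real (n - Suc k)) (walk n x k \<omega>)"
  let ?f = "\<lambda>\<omega>. ?p \<omega> * f (fun_upd \<omega> (Suc k) 1) + (1 - ?p \<omega>) * f (fun_upd \<omega> (Suc k) 0)"
  have step: "measure_pmf.expectation
      (map_pmf (\<lambda>b. fun_upd \<omega> (Suc k) (of_bool b)) (bernoulli_pmf (?p \<omega>))) f = ?f \<omega>" for \<omega>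
    using up_prob_bounds[of "real (n - Suc k)" "walk n x k \<omega>"] walk_bounds[of k \<omega>] by simp
  have "measure_pmf.expectation (coins n x (Suc k)) f =
      (\<Sum>\<omega>\<in>set_pmf (coins n x k). pmf (coins n x k) \<omega> *\<^sub>R ?f \<omega>)"
    unfolding coins.simps step[symmetric]
    by (rule pmf_expectation_bind) (simp_all add: finite_set_pmf_coins)
  also have "\<dots> = measure_pmf.expectation (coins n x k) ?f"
    by (rule integral_measure_pmf[symmetric]) (simp_all add: finite_set_pmf_coins)
  finally show ?thesis .
qed

text \<open>The two weights of a later coin add up to 1, so the laws are consistent and all
  computations can refer to \<open>coins n x n\<close>.\<close>

lemma expectation_coins_determined:
  fixes f :: "(nat \<Rightarrow> real) \<Rightarrow> real"
  assumes "determined_upto k f" "k \<le> l"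
  shows "measure_pmf.expectation (coins n x l) f = measure_pmf.expectation (coins n x k) f"
  using assms(2)
proof (induction rule: dec_induct)
  case (step l)
  have "f (fun_upd \<omega> (Suc l) y) = f \<omega>" for \<omega> y
    using determined_upto_fun_upd[OF assms(1)] step.hyps by simp
  then have "measure_pmf.expectation (coins n x (Suc l)) f = measure_pmf.expectation (coins n x l) f"
    unfolding expectation_coins_Suc by (simp flip: distrib_right)
  then show ?case
    using step.IH by (rule trans)
qed simp

text \<open>Says that \<open>h\<close> is the conditional expectation of \<open>f\<close> given the
  first \<open>k\<close> coins, tested against \<open>g\<close>. It yields both the martingale
  property and the conditional variance.\<close>

lemma expectation_coins_step:
  fixes f g :: "(nat \<Rightarrow> real) \<Rightarrow> real"
  assumes k: "k < n" and g: "determined_upto k g" and f: "determined_upto (Suc k) f"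
    and h: "\<And>\<omega>. up_prob (real (n - Suc k)) (walk n x k \<omega>) * f (fun_upd \<omega> (Suc k) 1) +
      (1 - up_prob (real (n - Suc k)) (walk n x k \<omega>)) * f (fun_upd \<omega> (Suc k) 0) = h \<omega>"
    and hk: "determined_upto k h"
  shows "measure_pmf.expectation (coins n x n) (\<lambda>\<omega>. g \<omega> * f \<omega>) =
    measure_pmf.expectation (coins n x n) (\<lambda>\<omega>. g \<omega> * h \<omega>)"
proof -
  have "determined_upto (Suc k) (\<lambda>\<omega>. g \<omega> * f \<omega>)"
    by (intro determined_upto_comp2[where h = "(*)"] determined_upto_mono[OF g] f) simp
  then have "measure_pmf.expectation (coins n x n) (\<lambda>\<omega>. g \<omega> * f \<omega>) =
      measure_pmf.expectation (coins n x (Suc k)) (\<lambda>\<omega>. g \<omega> * f \<omega>)"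
    using k by (intro expectation_coins_determined) simp_all
  also have "\<dots> = measure_pmf.expectation (coins n x k) (\<lambda>\<omega>. g \<omega> * h \<omega>)"
    unfolding expectation_coins_Suc
  proof (intro Bochner_Integration.integral_cong refl)
    fix \<omega> :: "nat \<Rightarrow> real"
    have "g (fun_upd \<omega> (Suc k) y) = g \<omega>" for y
      by (rule determined_upto_fun_upd[OF g]) simp
    then show "up_prob (real (n - Suc k)) (walk n x k \<omega>) * (g (fun_upd \<omega> (Suc k) 1) * f (fun_upd \<omega> (Suc k) 1)) +
        (1 - up_prob (real (n - Suc k)) (walk n x k \<omega>)) * (g (fun_upd \<omega> (Suc k) 0) * f (fun_upd \<omega> (Suc k) 0)) =
        g \<omega> * h \<omega>"
      unfolding h[symmetric] by (simp add: algebra_simps)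
  qed
  also have "\<dots> = measure_pmf.expectation (coins n x n) (\<lambda>\<omega>. g \<omega> * h \<omega>)"
    using k by (intro expectation_coins_determined[symmetric] determined_upto_comp2[where h = "(*)"] g hk) simp
  finally show ?thesis .
qed

text \<open>Dependence on finitely many coordinates does not imply measurability, so the recursion
  is followed through the Borel functions \<open>up\<close> and \<open>down\<close>.\<close>

lemma walk_measurable:
  assumes "j \<le> k"
  shows "walk n x j \<in> borel_measurable (coordinate_filtration (measure_pmf P) k)"
  using assms
proof (induction j)
  case (Suc j)
  let ?F = "coordinate_filtration (measure_pmf P) k"
  have "(\<lambda>\<omega>. \<lambda>i\<in>{1..k}. \<omega> i) \<in> ?F \<rightarrow>\<^sub>M Pi\<^sub>M {1..k} (\<lambda>_. borel :: real measure)"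
    unfolding generated_filtration_def
    by (rule measurable_vimage_algebra1) (auto simp: space_PiM)
  from measurable_compose[OF this measurable_component_singleton, of "Suc j"]
  have [measurable]: "(\<lambda>\<omega>. \<omega> (Suc j)) \<in> borel_measurable ?F"
    using Suc.prems by simp
  have [measurable]: "walk n x j \<in> borel_measurable ?F"
    using Suc by simp
  show ?case
    by simp
next
  case 0
  have "walk n x 0 = (\<lambda>_. x)"
    by (simp add: fun_eq_iff)
  then show ?case by simp
qed

lemma martingale_walk:
  "martingale_wrt (measure_pmf (coins n x n)) (\<lambda>_. borel) (\<lambda>i \<omega>. \<omega> i) n (walk n x)"
  unfolding martingale_wrt_def
proof (intro conjI allI ballI impI)
  fix k assume k: "k < n"
  let ?M = "measure_pmf (coins n x n)"
  interpret finite_measure_subalgebra ?M "coordinate_filtration ?M k"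
    by unfold_locales (auto intro!: subalgebra_generated_filtration)
  show "AE \<omega> in ?M. real_cond_exp ?M (coordinate_filtration ?M k) (walk n x (Suc k)) \<omega> = walk n x k \<omega>"
  \<comment> \<open>It suffices to compare integrals over sets \<open>A\<close> known at time
    \<open>k\<close>; the indicator of \<open>A\<close> takes the place of \<open>g\<close> in
    \<open>expectation_coins_step\<close>.\<close>
  proof (rule real_cond_exp_charact)
    fix A assume "A \<in> sets (coordinate_filtration ?M k)"
    then show "(LINT \<omega>:A|?M. walk n x (Suc k) \<omega>) = (LINT \<omega>:A|?M. walk n x k \<omega>)"
      unfolding set_lebesgue_integral_def real_scaleR_def
      using up_prob_mean walk_bounds
      by (intro expectation_coins_step[OF k] determined_upto_indicator determined_upto_walk)
         (auto simp: determined_upto_fun_upd[OF determined_upto_walk])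
  qed (auto intro: walk_measurable)
qed (auto intro: walk_measurable)

section \<open>Optional stopping of the squared increments\<close>

definition gap :: "nat \<Rightarrow> (nat \<Rightarrow> real) \<Rightarrow> real" where
  "gap k \<omega> = (walk n x (Suc k) \<omega> - walk n x k \<omega>)\<^sup>2"

text \<open>The indifference equation with \<open>m = n - Suc k\<close>. The last step is excluded
  because \<open>m = 0\<close> there and cannot be divided by.\<close>

lemma gap_eq:
  assumes "Suc k < n"
  shows "gap k \<omega> = walk n x (Suc k) \<omega> * (1 - walk n x (Suc k) \<omega>) / real (n - Suc k)"
  using root_indifferent[of "real (n - Suc k)" "walk n x k \<omega>" "walk n x (Suc k) \<omega>"]
    walk_bounds[of k \<omega>] assms
  by (simp add: gap_def field_simps del: of_nat_diff)

lemma determined_upto_gap: "determined_upto (Suc k) (gap k)"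
  unfolding gap_def[abs_def]
  by (intro determined_upto_comp2[where h = "\<lambda>a b. (a - b)\<^sup>2"] determined_upto_walk
      determined_upto_mono[OF determined_upto_walk[of k]]) auto

text \<open>This is \<open>up_prob_variance\<close> with \<open>m + 1 = n - k\<close>. For positive
  \<open>k\<close> the factor beside \<open>g\<close> on the right is \<open>gap (k - 1)\<close> by
  \<open>gap_eq\<close>, so the squared increments form a martingale.\<close>

lemma expectation_gap:
  assumes k: "k < n" and g: "determined_upto k g"
  shows "measure_pmf.expectation (coins n x n) (\<lambda>\<omega>. g \<omega> * gap k \<omega>) =
    measure_pmf.expectation (coins n x n)
      (\<lambda>\<omega>. g \<omega> * (walk n x k \<omega> * (1 - walk n x k \<omega>) / real (n - k)))"
proof (rule expectation_coins_step[OF k g determined_upto_gap])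
  show "determined_upto k (\<lambda>\<omega>. walk n x k \<omega> * (1 - walk n x k \<omega>) / real (n - k))"
    by (rule determined_upto_comp2[where h = "\<lambda>a b. a * (1 - b) / real (n - k)"])
       (rule determined_upto_walk)+
  fix \<omega> :: "nat \<Rightarrow> real"
  have "real (n - Suc k) + 1 = real (n - k)"
    using k by simp
  with up_prob_variance[of "real (n - Suc k)" "walk n x k \<omega>"] walk_bounds[of k \<omega>]
  show "up_prob (real (n - Suc k)) (walk n x k \<omega>) * gap k (fun_upd \<omega> (Suc k) 1) +
      (1 - up_prob (real (n - Suc k)) (walk n x k \<omega>)) * gap k (fun_upd \<omega> (Suc k) 0) =
      walk n x k \<omega> * (1 - walk n x k \<omega>) / real (n - k)"
    by (simp add: gap_def determined_upto_fun_upd[OF determined_upto_walk] del: of_nat_diff)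
qed

lemma stopped_gap_walk:
  assumes n: "n \<ge> 1"
    and \<tau>: "\<tau> \<in> stopping_times_upto (measure_pmf (coins n x n)) (\<lambda>_. borel) (\<lambda>i \<omega>. \<omega> i) n"
  shows "stopped_gap (measure_pmf (coins n x n)) (walk n x) \<tau> = x * (1 - x) / real n"
proof -
  let ?M = "measure_pmf (coins n x n)"
  \<comment> \<open>The event is the complement of \<open>\<tau> \<le> Suc k\<close>, hence decided
    before the coin \<open>k + 2\<close> that enters \<open>gap (Suc k)\<close>.\<close>
  define g where "g k = (indicator {\<omega>. Suc k < \<tau> \<omega>} :: _ \<Rightarrow> real)" for k
  have \<tau>_bounds: "\<tau> \<omega> \<in> {1..n}" for \<omega>
    using \<tau> by (auto simp: stopping_times_upto_def)
  have g: "determined_upto (Suc k) (g k)" for k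
  proof -
    have "Measurable.pred (coordinate_filtration ?M (Suc k)) (\<lambda>\<omega>. Suc k < \<tau> \<omega>)"
      using \<tau> stopping_timeD2 by (auto simp: stopping_times_upto_def)
    then have "{\<omega>. Suc k < \<tau> \<omega>} \<in> sets (coordinate_filtration ?M (Suc k))"
      by (simp add: pred_def)
    then show ?thesis
      unfolding g_def by (rule determined_upto_indicator)
  qed
  \<comment> \<open>Stopping at \<open>Suc j\<close> pays \<open>gap j\<close>, so exactly the
    increments with \<open>k < j\<close> are collected.\<close>
  have telescope: "(walk n x (\<tau> \<omega>) \<omega> - walk n x (\<tau> \<omega> - 1) \<omega>)\<^sup>2 =
      gap 0 \<omega> + (\<Sum>k<n - 1. g k \<omega> * (gap (Suc k) \<omega> - gap k \<omega>))" for \<omega>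
  proof -
    obtain j where j: "\<tau> \<omega> = Suc j" "j \<le> n - 1"
      using \<tau>_bounds[of \<omega>] by (cases "\<tau> \<omega>") auto
    have "(\<Sum>k<n - 1. g k \<omega> * (gap (Suc k) \<omega> - gap k \<omega>)) = (\<Sum>k<j. gap (Suc k) \<omega> - gap k \<omega>)"
      using j by (intro sum.mono_neutral_cong_right) (auto simp: g_def)
    also have "\<dots> = gap j \<omega> - gap 0 \<omega>"
      by (rule sum_lessThan_telescope)
    also have "gap j \<omega> = (walk n x (\<tau> \<omega>) \<omega> - walk n x (\<tau> \<omega> - 1) \<omega>)\<^sup>2"
      by (simp add: j(1) gap_def del: walk.simps)
    finally show ?thesis by simp
  qed
  \<comment> \<open>At index \<open>Suc k\<close>, \<open>expectation_gap\<close> replaces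
    \<open>gap (Suc k)\<close> by an expression that \<open>gap_eq\<close> identifies with
    \<open>gap k\<close>.\<close>
  have zero: "measure_pmf.expectation (coins n x n) (\<lambda>\<omega>. g k \<omega> * (gap (Suc k) \<omega> - gap k \<omega>)) = 0"
    if "k < n - 1" for k
    using expectation_gap[OF _ g, of k] that
    by (simp add: right_diff_distrib gap_eq del: of_nat_diff)
  have "stopped_gap ?M (walk n x) \<tau> = measure_pmf.expectation (coins n x n) (gap 0)"
    unfolding stopped_gap_def telescope by (simp add: zero)
  also have "\<dots> = x * (1 - x) / real n"
    using expectation_gap[of 0 "\<lambda>_. 1"] n by (simp add: determined_upto_def)
  finally show ?thesis .
qed

end

theorem theorem4:
  fixes n :: nat
  assumes "n \<ge> 1"
  shows
    "(\<forall>(M :: 'a measure) (S :: nat \<Rightarrow> 'e measure) E X.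
        prob_space M \<and> martingale_wrt M S E n X \<and> (AE \<omega> in M. X n \<omega> \<in> {0, 1}) \<longrightarrow>
        (\<forall>\<omega>\<in>space M.
           (SUP \<tau>\<in>stopping_times_upto M S E n. stopped_gap M X \<tau>)
             \<ge> 1 / real n * (X 0 \<omega> * (1 - X 0 \<omega>)))) \<and>
     (\<forall>x\<^sub>0\<in>{0..1 :: real}.
        \<exists>(M :: (nat \<Rightarrow> real) measure) (S :: nat \<Rightarrow> real measure) E X.
          prob_space M \<and> martingale_wrt M S E n X \<and>
          (\<forall>\<omega>\<in>space M. X 0 \<omega> = x\<^sub>0) \<and> (\<forall>\<omega>\<in>space M. X n \<omega> \<in> {0, 1}) \<and>
          (\<forall>\<tau>\<in>stopping_times_upto M S E n.
             stopped_gap M X \<tau> = 1 / real n * (x\<^sub>0 * (1 - x\<^sub>0))))"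
proof (intro conjI allI ballI impI)
  fix M :: "'a measure" and S :: "nat \<Rightarrow> 'e measure" and E X \<omega>
  assume *: "prob_space M \<and> martingale_wrt M S E n X \<and> (AE \<omega> in M. X n \<omega> \<in> {0, 1})"
    and \<omega>: "\<omega> \<in> space M"
  interpret prob_space M
    using * by blast
  show "(SUP \<tau>\<in>stopping_times_upto M S E n. stopped_gap M X \<tau>) \<ge> 1 / real n * (X 0 \<omega> * (1 - X 0 \<omega>))"
    using sup_stopped_gap_ge[OF assms _ _ \<omega>] * by blast
next
  fix x\<^sub>0 :: real
  assume x: "x\<^sub>0 \<in> {0..1}"
  \<comment> \<open>Writing \<open>n\<close> as a successor exposes the last move, which goes to
    \<open>up 0\<close> or \<open>down 0\<close>.\<close>
  obtain k where "n = Suc k"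
    using assms by (cases n) auto
  then have "walk n x\<^sub>0 n \<omega> \<in> {0, 1}" for \<omega>
    by simp
  then show "\<exists>(M :: (nat \<Rightarrow> real) measure) (S :: nat \<Rightarrow> real measure) E X.
      prob_space M \<and> martingale_wrt M S E n X \<and>
      (\<forall>\<omega>\<in>space M. X 0 \<omega> = x\<^sub>0) \<and> (\<forall>\<omega>\<in>space M. X n \<omega> \<in> {0, 1}) \<and>
      (\<forall>\<tau>\<in>stopping_times_upto M S E n.
         stopped_gap M X \<tau> = 1 / real n * (x\<^sub>0 * (1 - x\<^sub>0)))"
    using measure_pmf.prob_space_axioms martingale_walk[OF x] stopped_gap_walk[OF x assms]
    by (intro exI[of _ "measure_pmf (coins n x\<^sub>0 n)"] exI[of _ "\<lambda>_. borel"]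
        exI[of _ "\<lambda>i \<omega>. \<omega> i"] exI[of _ "walk n x\<^sub>0"]) simp
qed

end
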